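(* Let $a,b\in\mathbb{R}$ with $a<b$, and let $n\in\mathbb{N}$, $n\ge 2$. Then for all $\alpha,\lambda\in[0,1]$ and $q\ge 1$, $$\left|\lambda A_\alpha(a^n,b^n)+(1-\lambda)A_\alpha^n(a,b)-L_n^n(a,b)\right|$$ $$\le\begin{cases}n(b-a)(\gamma_2+\upsilon_2)E^{1/q}, & \alpha\lambda\le 1-\alpha\le 1-\lambda(1-\alpha),\\ n(b-a)(\gamma_2+\upsilon_1)E^{1/q}, & \alpha\lambda\le 1-\lambda(1-\alpha)\le 1-\alpha,\\ n(b-a)(\gamma_1+\upsilon_2)E^{1/q}, & 1-\alpha\le\alpha\lambda\le 1-\lambda(1-\alpha),\end{cases}$$ where $E=\sup\{|a|^{(n-1)q},|b|^{(n-1)q}\}$ and $$\gamma_1=(1-\alpha)\left[\alpha\lambda-\frac{1-\alpha}{2}\right],\qquad \gamma_2=(\alpha\lambda)^2-\gamma_1,$$ $$\upsilon_1=\frac{1-(1-\alpha)^2}{2}-\alpha\left[1-\lambda(1-\alpha)\right],\qquad \upsilon_2=\frac{1+(1-\alpha)^2}{2}-(\lambda+1)(1-\alpha)\left[1-\lambda(1-\alpha)\right].$$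
   Context: Weighted arithmetic mean: $A_\alpha(x,y)=\alpha x+(1-\alpha)y$ for $x,y\in\mathbb{R}$; $A_\alpha^n(a,b)=(A_\alpha(a,b))^n$. $n$-logarithmic mean: $L_n(a,b)=\left(\frac{b^{n+1}-a^{n+1}}{(n+1)(b-a)}\right)^{1/n}$ for $a\ne b$, so that $L_n^n(a,b)=(L_n(a,b))^n=\frac{b^{n+1}-a^{n+1}}{(n+1)(b-a)}$. *)

theory Defs
  imports Complex_Main
begin

definition weighted_mean :: "real \<Rightarrow> real \<Rightarrow> real \<Rightarrow> real" where
  "weighted_mean \<alpha> x y = \<alpha> * x + (1 - \<alpha>) * y"

text \<open>
  Intended for \<open>a \<noteq> b\<close> only. The radicand may be negative, but only for odd
  \<open>n\<close>; there \<^const>\<open>root\<close> is the real odd root, as opposed to \<^const>\<open>powr\<close>,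
  so the \<open>n\<close>-th power of the mean is the radicand for all \<open>a \<noteq> b\<close> and \<open>n \<ge> 1\<close>.
\<close>

definition log_mean :: "nat \<Rightarrow> real \<Rightarrow> real \<Rightarrow> real" where
  "log_mean n a b = root n ((b ^ (n + 1) - a ^ (n + 1)) / ((real n + 1) * (b - a)))"

definition \<gamma>\<^sub>1 :: "real \<Rightarrow> real \<Rightarrow> real" where
  "\<gamma>\<^sub>1 \<alpha> lam = (1 - \<alpha>) * (\<alpha> * lam - (1 - \<alpha>) / 2)"

definition \<gamma>\<^sub>2 :: "real \<Rightarrow> real \<Rightarrow> real" where
  "\<gamma>\<^sub>2 \<alpha> lam = (\<alpha> * lam)\<^sup>2 - \<gamma>\<^sub>1 \<alpha> lam"

definition \<upsilon>\<^sub>1 :: "real \<Rightarrow> real \<Rightarrow> real" where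
  "\<upsilon>\<^sub>1 \<alpha> lam = (1 - (1 - \<alpha>)\<^sup>2) / 2 - \<alpha> * (1 - lam * (1 - \<alpha>))"

definition \<upsilon>\<^sub>2 :: "real \<Rightarrow> real \<Rightarrow> real" where
  "\<upsilon>\<^sub>2 \<alpha> lam = (1 + (1 - \<alpha>)\<^sup>2) / 2 - (lam + 1) * (1 - \<alpha>) * (1 - lam * (1 - \<alpha>))"

definition endpoint_sup :: "nat \<Rightarrow> real \<Rightarrow> real \<Rightarrow> real \<Rightarrow> real" where
  "endpoint_sup n q a b = Sup {\<bar>a\<bar> powr ((real n - 1) * q), \<bar>b\<bar> powr ((real n - 1) * q)}"

end

theory Submission
  imports Defs
begin

text \<open>
  Put \<open>f x = x ^ n\<close> and \<open>y x = a + x * (b - a)\<close>. Integration by parts writes the signed error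
  as \<open>b - a\<close> times the integral of \<open>k x * f' (y x)\<close> over \<open>[0, 1]\<close>, where \<open>k x = x - \<alpha> * lam\<close> on
  \<open>[0, 1 - \<alpha>]\<close> and \<open>k x = x - (1 - lam * (1 - \<alpha>))\<close> on \<open>[1 - \<alpha>, 1]\<close>. Since \<open>f'\<close> is bounded by
  \<open>n * E powr (1 / q)\<close>, the error is at most \<open>b - a\<close> times this bound times the integral of \<open>\<bar>k\<bar>\<close>,
  and the three cases record on which side of \<open>1 - \<alpha>\<close> the zeros of \<open>k\<close> lie.
  Antiderivatives and monotonicity replace the integrals.
\<close>

text \<open>Both \<open>H - G\<close> and \<open>H + G\<close> have nonnegative derivative, hence do
  not decrease on the interval. This takes the place of bounding an integral by the integral of the
  absolute value.\<close>

lemma abs_increment_le_of_abs_deriv_le: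
  fixes G H :: "real \<Rightarrow> real"
  assumes "s \<le> t"
    and G: "\<And>x. s \<le> x \<Longrightarrow> x \<le> t \<Longrightarrow> (G has_real_derivative G' x) (at x)"
    and H: "\<And>x. s \<le> x \<Longrightarrow> x \<le> t \<Longrightarrow> (H has_real_derivative H' x) (at x)"
    and le: "\<And>x. s \<le> x \<Longrightarrow> x \<le> t \<Longrightarrow> \<bar>G' x\<bar> \<le> H' x"
  shows "\<bar>G t - G s\<bar> \<le> H t - H s"
proof -
  have "H s - G s \<le> H t - G t"
  proof (rule DERIV_nonneg_imp_nondecreasing[OF \<open>s \<le> t\<close>])
    fix x assume x: "s \<le> x" "x \<le> t"
    have "((\<lambda>x. H x - G x) has_real_derivative H' x - G' x) (at x)"
      by (intro DERIV_diff G H x)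
    with le[OF x] show "\<exists>y. ((\<lambda>x. H x - G x) has_real_derivative y) (at x) \<and> 0 \<le> y"
      by (intro exI[of _ "H' x - G' x"]) auto
  qed
  moreover have "H s + G s \<le> H t + G t"
  proof (rule DERIV_nonneg_imp_nondecreasing[OF \<open>s \<le> t\<close>])
    fix x assume x: "s \<le> x" "x \<le> t"
    have "((\<lambda>x. H x + G x) has_real_derivative H' x + G' x) (at x)"
      by (intro DERIV_add G H x)
    with le[OF x] show "\<exists>y. ((\<lambda>x. H x + G x) has_real_derivative y) (at x) \<and> 0 \<le> y"
      by (intro exI[of _ "H' x + G' x"]) auto
  qed
  ultimately show ?thesis by linarith
qed

text \<open>To the right of \<open>c\<close> the kernel is nonnegative, so
  \<open>K * (x - c)\<close> dominates the derivative, and its antiderivative is \<open>K\<close>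
  times half a square. The factor of \<open>K\<close> is the integral of
  \<open>\<bar>x - c\<bar>\<close> from \<open>s\<close> to \<open>t\<close>.\<close>

lemma linear_kernel_bound_right:
  fixes G g :: "real \<Rightarrow> real"
  assumes "c \<le> s" "s \<le> t"
    and G: "\<And>x. s \<le> x \<Longrightarrow> x \<le> t \<Longrightarrow> (G has_real_derivative (x - c) * g x) (at x)"
    and g: "\<And>x. s \<le> x \<Longrightarrow> x \<le> t \<Longrightarrow> \<bar>g x\<bar> \<le> K"
  shows "\<bar>G t - G s\<bar> \<le> K * (((t - c)\<^sup>2 - (s - c)\<^sup>2) / 2)"
proof -
  have "\<bar>G t - G s\<bar> \<le> K * (t - c)\<^sup>2 / 2 - K * (s - c)\<^sup>2 / 2"
  proof (rule abs_increment_le_of_abs_deriv_le[OF \<open>s \<le> t\<close> G])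
    fix x assume x: "s \<le> x" "x \<le> t"
    show "((\<lambda>x. K * (x - c)\<^sup>2 / 2) has_real_derivative K * (x - c)) (at x)"
      by (auto intro!: derivative_eq_intros)
    have "\<bar>x - c\<bar> * \<bar>g x\<bar> \<le> (x - c) * K"
      using g[OF x] x \<open>c \<le> s\<close> by (intro mult_mono) auto
    then show "\<bar>(x - c) * g x\<bar> \<le> K * (x - c)"
      by (simp add: abs_mult mult.commute)
  qed
  then show ?thesis by (simp add: algebra_simps)
qed

lemma linear_kernel_bound_left:
  fixes G g :: "real \<Rightarrow> real"
  assumes "s \<le> t" "t \<le> c"
    and G: "\<And>x. s \<le> x \<Longrightarrow> x \<le> t \<Longrightarrow> (G has_real_derivative (x - c) * g x) (at x)"
    and g: "\<And>x. s \<le> x \<Longrightarrow> x \<le> t \<Longrightarrow> \<bar>g x\<bar> \<le> K"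
  shows "\<bar>G t - G s\<bar> \<le> K * (((s - c)\<^sup>2 - (t - c)\<^sup>2) / 2)"
proof -
  have "\<bar>G t - G s\<bar> \<le> - K * (t - c)\<^sup>2 / 2 - - K * (s - c)\<^sup>2 / 2"
  proof (rule abs_increment_le_of_abs_deriv_le[OF \<open>s \<le> t\<close> G])
    fix x assume x: "s \<le> x" "x \<le> t"
    show "((\<lambda>x. - K * (x - c)\<^sup>2 / 2) has_real_derivative K * (c - x)) (at x)"
      by (auto intro!: derivative_eq_intros simp: field_simps)
    have "\<bar>x - c\<bar> * \<bar>g x\<bar> \<le> (c - x) * K"
      using g[OF x] x \<open>t \<le> c\<close> by (intro mult_mono) auto
    then show "\<bar>(x - c) * g x\<bar> \<le> K * (c - x)"
      by (simp add: abs_mult mult.commute)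
  qed
  then show ?thesis by (simp add: algebra_simps)
qed

text \<open>The kernel changes sign at \<open>c\<close>; splitting there reduces to the two
  one-sided bounds.\<close>

lemma linear_kernel_bound_mid:
  fixes G g :: "real \<Rightarrow> real"
  assumes "s \<le> c" "c \<le> t"
    and G: "\<And>x. s \<le> x \<Longrightarrow> x \<le> t \<Longrightarrow> (G has_real_derivative (x - c) * g x) (at x)"
    and g: "\<And>x. s \<le> x \<Longrightarrow> x \<le> t \<Longrightarrow> \<bar>g x\<bar> \<le> K"
  shows "\<bar>G t - G s\<bar> \<le> K * (((s - c)\<^sup>2 + (t - c)\<^sup>2) / 2)"
proof -
  have "\<bar>G c - G s\<bar> \<le> K * (((s - c)\<^sup>2 - (c - c)\<^sup>2) / 2)"
    using assms by (intro linear_kernel_bound_left[where g = g]) auto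
  moreover have "\<bar>G t - G c\<bar> \<le> K * (((t - c)\<^sup>2 - (c - c)\<^sup>2) / 2)"
    using assms by (intro linear_kernel_bound_right[where g = g]) auto
  moreover have "\<bar>G t - G s\<bar> \<le> \<bar>G c - G s\<bar> + \<bar>G t - G c\<bar>"
    by linarith
  ultimately have "\<bar>G t - G s\<bar> \<le> K * ((s - c)\<^sup>2 / 2) + K * ((t - c)\<^sup>2 / 2)"
    by simp
  then show ?thesis by (simp add: algebra_simps)
qed

text \<open>For even \<open>n\<close> the exponent \<open>n + 1\<close> is odd, so monotonicity of
  odd powers makes the radicand nonnegative; for odd \<open>n\<close> the real root inverts the
  power whatever the sign.\<close>

lemma log_mean_power:
  assumes "a < b" "n \<noteq> 0"
  shows "log_mean n a b ^ n = (b ^ (n + 1) - a ^ (n + 1)) / ((real n + 1) * (b - a))"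
proof (cases "even n")
  case True
  then have "a ^ (n + 1) \<le> b ^ (n + 1)"
    using \<open>a < b\<close> by (intro power_mono_odd) auto
  then have "0 \<le> (b ^ (n + 1) - a ^ (n + 1)) / ((real n + 1) * (b - a))"
    using \<open>a < b\<close> by (intro divide_nonneg_nonneg) auto
  then show ?thesis
    unfolding log_mean_def using \<open>n \<noteq> 0\<close> by (intro real_root_pow_pos2) auto
next
  case False
  then show ?thesis
    unfolding log_mean_def by (rule odd_real_root_pow)
qed

lemma endpoint_sup_powr:
  assumes "n \<ge> 2" "q \<ge> 1"
  shows "endpoint_sup n q a b powr (1 / q) = max \<bar>a\<bar> \<bar>b\<bar> ^ (n - 1)"
proof -
  have "endpoint_sup n q a b = max \<bar>a\<bar> \<bar>b\<bar> powr ((real n - 1) * q)"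
    using assms by (auto simp: endpoint_sup_def cSup_eq_Max max_def intro!: antisym powr_mono2)
  then have "endpoint_sup n q a b powr (1 / q) = max \<bar>a\<bar> \<bar>b\<bar> powr (real n - 1)"
    using assms by (simp add: powr_powr)
  \<comment> \<open>Here \<open>n \<ge> 2\<close> matters: with exponent 0 and base 0,
    \<open>powr\<close> gives 0 but the natural power gives 1.\<close>
  also have "\<dots> = max \<bar>a\<bar> \<bar>b\<bar> ^ (n - 1)"
    using assms powr_realpow'[of "max \<bar>a\<bar> \<bar>b\<bar>" "n - 1"] by (simp add: of_nat_diff)
  finally show ?thesis .
qed

theorem proposition1:
  fixes a b \<alpha> lam q :: real and n :: nat
  assumes "a < b" and "n \<ge> 2"
    and "\<alpha> \<in> {0..1}" and "lam \<in> {0..1}" and "q \<ge> 1"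
  defines "D \<equiv> \<bar>lam * weighted_mean \<alpha> (a ^ n) (b ^ n)
                 + (1 - lam) * weighted_mean \<alpha> a b ^ n - log_mean n a b ^ n\<bar>"
    and "E \<equiv> endpoint_sup n q a b"
  shows "(\<alpha> * lam \<le> 1 - \<alpha> \<and> 1 - \<alpha> \<le> 1 - lam * (1 - \<alpha>) \<longrightarrow>
            D \<le> real n * (b - a) * (\<gamma>\<^sub>2 \<alpha> lam + \<upsilon>\<^sub>2 \<alpha> lam) * E powr (1 / q)) \<and>
         (\<alpha> * lam \<le> 1 - lam * (1 - \<alpha>) \<and> 1 - lam * (1 - \<alpha>) \<le> 1 - \<alpha> \<longrightarrow>
            D \<le> real n * (b - a) * (\<gamma>\<^sub>2 \<alpha> lam + \<upsilon>\<^sub>1 \<alpha> lam) * E powr (1 / q)) \<and>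
         (1 - \<alpha> \<le> \<alpha> * lam \<and> \<alpha> * lam \<le> 1 - lam * (1 - \<alpha>) \<longrightarrow>
            D \<le> real n * (b - a) * (\<gamma>\<^sub>1 \<alpha> lam + \<upsilon>\<^sub>2 \<alpha> lam) * E powr (1 / q))"
proof -
  have \<alpha>: "0 \<le> \<alpha>" "\<alpha> \<le> 1" and lam: "0 \<le> lam" "lam \<le> 1"
    using assms(3,4) by auto
  define L where "L = lam * weighted_mean \<alpha> (a ^ n) (b ^ n)
    + (1 - lam) * weighted_mean \<alpha> a b ^ n - log_mean n a b ^ n"
  define M where "M = max \<bar>a\<bar> \<bar>b\<bar> ^ (n - 1)"
  define y where "y x = a + x * (b - a)" for x
  \<comment> \<open>One factor \<open>b - a\<close> comes from the chain rule, the other from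
    multiplying the error by \<open>b - a\<close>, which clears the denominator of the logarithmic
    mean.\<close>
  define g where "g x = (b - a)\<^sup>2 * (real n * y x ^ (n - 1))" for x
  \<comment> \<open>Integration by parts suggests this antiderivative of
    \<open>(x - c) * g x\<close>: on differentiating, the two terms in \<open>y x ^ n\<close>
    cancel.\<close>
  define G where "G c x = (b - a) * (x - c) * y x ^ n - y x ^ (n + 1) / (real n + 1)" for c x
  define K where "K = (b - a)\<^sup>2 * (real n * M)"
  have deriv: "(G c has_real_derivative (x - c) * g x) (at x)" for c x
    unfolding G_def[abs_def] y_def g_def
    by (rule derivative_eq_intros refl | simp)+
       (simp add: field_simps power2_eq_square)
  \<comment> \<open>On the unit interval \<open>y x\<close> is a convex combination of
    \<open>a\<close> and \<open>b\<close>.\<close>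
  have bound: "\<bar>g x\<bar> \<le> K" if "0 \<le> x" "x \<le> 1" for x
  proof -
    have "y x = (1 - x) * a + x * b"
      by (simp add: y_def algebra_simps)
    also have "\<bar>\<dots>\<bar> \<le> (1 - x) * \<bar>a\<bar> + x * \<bar>b\<bar>"
      using that abs_triangle_ineq[of "(1 - x) * a" "x * b"] by (simp add: abs_mult)
    also have "\<dots> \<le> max \<bar>a\<bar> \<bar>b\<bar>"
      using that by (intro convex_bound_le) auto
    finally have "\<bar>y x\<bar> ^ (n - 1) \<le> M"
      unfolding M_def by (intro power_mono) auto
    then show ?thesis
      unfolding g_def K_def by (simp add: abs_mult power_abs mult_left_mono)
  qed
  define u where "u = 1 - \<alpha>"
  define c1 where "c1 = \<alpha> * lam"
  define c2 where "c2 = 1 - lam * (1 - \<alpha>)"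
  have u: "0 \<le> u" "u \<le> 1" and c1: "0 \<le> c1" and c2: "c2 \<le> 1"
    using \<alpha> lam by (auto simp: u_def c1_def c2_def)
  have "weighted_mean \<alpha> a b = y u"
    by (simp add: weighted_mean_def y_def u_def algebra_simps)
  moreover have "(b - a) * log_mean n a b ^ n = (b ^ (n + 1) - a ^ (n + 1)) / (real n + 1)"
    using log_mean_power[OF \<open>a < b\<close>, of n] \<open>n \<ge> 2\<close> \<open>a < b\<close> by simp
  moreover have "y 0 = a" "y 1 = b"
    by (auto simp: y_def)
  \<comment> \<open>The outer endpoints contribute the weights \<open>c1 = \<alpha> * lam\<close> of
    \<open>a ^ n\<close> and \<open>1 - c2 = lam * (1 - \<alpha>)\<close> of \<open>b ^ n\<close>.
    At \<open>u\<close> the two pieces leave the weight \<open>c2 - c1 = 1 - lam\<close>, and the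
    terms with exponent \<open>n + 1\<close> telescope to the logarithmic mean.\<close>
  ultimately have L: "(b - a) * L = (G c1 u - G c1 0) + (G c2 1 - G c2 u)"
    unfolding L_def weighted_mean_def[of \<alpha> "a ^ n"] G_def
    by (simp add: u_def c1_def c2_def diff_divide_distrib algebra_simps)
  have est: "D \<le> real n * (b - a) * (p + r) * E powr (1 / q)"
    if "\<bar>G c1 u - G c1 0\<bar> \<le> K * p" "\<bar>G c2 1 - G c2 u\<bar> \<le> K * r" for p r
  proof -
    have "(b - a) * D = \<bar>(b - a) * L\<bar>"
      using \<open>a < b\<close> by (simp add: D_def L_def abs_mult)
    also have "\<dots> \<le> K * (p + r)"
      using that unfolding L by (simp add: distrib_left)
    also have "\<dots> = (b - a) * (real n * (b - a) * (p + r) * E powr (1 / q))"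
      unfolding E_def endpoint_sup_powr[OF \<open>n \<ge> 2\<close> \<open>q \<ge> 1\<close>] K_def M_def
      by (simp add: power2_eq_square)
    finally show ?thesis
      using \<open>a < b\<close> by simp
  qed
  \<comment> \<open>This claim and the next three treat each piece of the kernel according to
    whether its zero is inside the piece or beyond \<open>u\<close>; each \<open>eq\<close>
    recognises the given coefficient as the integral of the absolute kernel.\<close>
  have \<gamma>1: "\<bar>G c1 u - G c1 0\<bar> \<le> K * \<gamma>\<^sub>1 \<alpha> lam" if "u \<le> c1"
  proof -
    have eq: "\<gamma>\<^sub>1 \<alpha> lam = ((0 - c1)\<^sup>2 - (u - c1)\<^sup>2) / 2"
      by (simp add: \<gamma>\<^sub>1_def u_def c1_def power2_eq_square field_simps)
    show ?thesis
      unfolding eq using u by (intro linear_kernel_bound_left[OF \<open>0 \<le> u\<close> that deriv bound]) auto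
  qed
  have \<gamma>2: "\<bar>G c1 u - G c1 0\<bar> \<le> K * \<gamma>\<^sub>2 \<alpha> lam" if "c1 \<le> u"
  proof -
    have eq: "\<gamma>\<^sub>2 \<alpha> lam = ((0 - c1)\<^sup>2 + (u - c1)\<^sup>2) / 2"
      by (simp add: \<gamma>\<^sub>2_def \<gamma>\<^sub>1_def u_def c1_def power2_eq_square field_simps)
    show ?thesis
      unfolding eq using u by (intro linear_kernel_bound_mid[OF c1 that deriv bound]) auto
  qed
  have \<upsilon>1: "\<bar>G c2 1 - G c2 u\<bar> \<le> K * \<upsilon>\<^sub>1 \<alpha> lam" if "c2 \<le> u"
  proof -
    have eq: "\<upsilon>\<^sub>1 \<alpha> lam = ((1 - c2)\<^sup>2 - (u - c2)\<^sup>2) / 2"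
      by (simp add: \<upsilon>\<^sub>1_def u_def c2_def power2_eq_square field_simps)
    show ?thesis
      unfolding eq using u by (intro linear_kernel_bound_right[OF that \<open>u \<le> 1\<close> deriv bound]) auto
  qed
  have \<upsilon>2: "\<bar>G c2 1 - G c2 u\<bar> \<le> K * \<upsilon>\<^sub>2 \<alpha> lam" if "u \<le> c2"
  proof -
    have eq: "\<upsilon>\<^sub>2 \<alpha> lam = ((u - c2)\<^sup>2 + (1 - c2)\<^sup>2) / 2"
      by (simp add: \<upsilon>\<^sub>2_def u_def c2_def power2_eq_square field_simps)
    show ?thesis
      unfolding eq using u by (intro linear_kernel_bound_mid[OF that c2 deriv bound]) auto
  qed
  \<comment> \<open>Transitivity is needed for the second and third cases, where the position of one
    zero relative to \<open>u\<close> follows only through the other zero.\<close>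
  show ?thesis
    using est \<gamma>1 \<gamma>2 \<upsilon>1 \<upsilon>2 unfolding u_def c1_def c2_def by (blast intro: order_trans)
qed

end
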